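(* Let $n\ge2$, $\delta\in\mathbb R$ and $k,l,q\in\mathbb N$ with $0\le q\le\min(k,l)$. The restriction of $\mathcal C^t$ to $\mathcal S_{k,l,q}$ equals $$n(n+1)\delta(\delta-1)-2\left((n+1)\delta-n+q\right)(k+l)+2(k+l)^2+2q(q-1)$$ times the identity.
   Context: Everything is smooth; $x^1,\dots,x^n$ are the coordinates of $\mathbb R^n$, $\partial_i=\partial/\partial x^i$. For $\delta\in\mathbb R$, densities of weight $\delta$ are sections of the trivial line bundle $\Delta^\delta(\mathbb R^n)$, identified with functions $\phi$ with $L_X\phi=\sum_iX^i\partial_i\phi+\delta(\sum_i\partial_iX^i)\phi$. Symbols: $\mathcal S^{(2)}_\delta=\bigoplus_{k,l\ge0}\Gamma(\vee^kT\mathbb R^n\otimes\vee^lT\mathbb R^n\otimes\Delta^\delta(\mathbb R^n))$, whose elements are viewed as polynomials in two covariant variables $\alpha,\beta\in\mathbb R^{n*}$ (bihomogeneous of degree $(k,l)$ for the $(k,l)$ summand) with $\delta$-densities as coefficients, with the natural Lie derivative $L_XP=\sum_iX^i\partial_iP-\sum_{i,j}(\partial_jX^i)(\alpha_iD_{\alpha_j}+\beta_iD_{\beta_j})P+\delta(\sum_i\partial_iX^i)P$. As a $gl(n,\mathbb R)$-module, $\vee^k\mathbb R^n\otimes\vee^l\mathbb R^n=\bigoplus_{q=0}^{\min(k,l)}V_{k,l,q}$, where $V_{k,l,q}$ is the irreducible submodule described by the Young tableau with two lines of lengths $k+l-q$ and $q$; it has highest weight vector $(\alpha_1\beta_2-\alpha_2\beta_1)^q\alpha_1^{k-q}\beta_1^{l-q}$.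 Denote $\mathcal S_{k,l,q}=\Gamma(V_{k,l,q}\otimes\Delta^\delta(\mathbb R^n))\subset\mathcal S^{(2)}_\delta$. $sl_{n+1}$ is the Lie algebra of vector fields spanned by $\partial_i$, $x^j\partial_i$, $x^j\sum_ix^i\partial_i$. $\mathcal C^t$ is the Casimir operator of $sl_{n+1}$ acting on $\mathcal S^{(2)}_\delta$, namely $\mathcal C^t=\sum_{i\ne j}L_{e_{ij}}L_{e_{ij}^*}+\sum_i(L_{e_{ii}}L_{e_{ii}^*}+L_{e_i}L_{e_i^*}+L_{\epsilon^i}L_{\epsilon^{i*}})$, where $e_{ij}=-x^j\partial_i$, $e_{ij}^*=e_{ji}$ ($i\neq j$), $e_{ii}=-x^i\partial_i-\sum_kx^k\partial_k$, $e_{ii}^*=-x^i\partial_i$, $e_i=-\partial_i$, $\epsilon^i=x^i\sum_kx^k\partial_k$, $e_i^*=\epsilon^i$, $\epsilon^{i*}=e_i$. *)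

theory Defs
  imports "HOL-Analysis.Analysis"
begin

text \<open>
  R^n is \<open>real ^ 'n\<close>, with n = \<open>CARD('n)\<close>; covectors are given by their components, so they
  are also of type \<open>real ^ 'n\<close>. A symbol is a function \<open>P x \<alpha> \<beta>\<close> of the base point and of two
  covectors. Densities are functions; their weight only enters through the Lie derivative.
\<close>

definition pderivative :: "'n \<Rightarrow> (real ^ 'n \<Rightarrow> real) \<Rightarrow> real ^ 'n \<Rightarrow> real"
  where "pderivative i f x = deriv (\<lambda>t. f (x + t *\<^sub>R axis i 1)) 0"

primrec Ck :: "nat \<Rightarrow> (real ^ 'n \<Rightarrow> real) \<Rightarrow> bool"
  where
    "Ck 0 f \<longleftrightarrow> continuous_on UNIV f"
  | "Ck (Suc m) f \<longleftrightarrow> (\<forall>x. f differentiable (at x)) \<and> (\<forall>i. Ck m (pderivative i f))"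

definition smooth :: "(real ^ 'n \<Rightarrow> real) \<Rightarrow> bool"
  where "smooth f \<longleftrightarrow> (\<forall>m. Ck m f)"


subsection \<open>Polynomials in two covariant variables\<close>

type_synonym 'n bipoly = "real ^ 'n \<Rightarrow> real ^ 'n \<Rightarrow> real"

definition multi_indices :: "nat \<Rightarrow> ('n::finite \<Rightarrow> nat) set"
  where "multi_indices k = {a. (\<Sum>i\<in>UNIV. a i) = k}"

definition monomial_at :: "('n::finite \<Rightarrow> nat) \<Rightarrow> real ^ 'n \<Rightarrow> real"
  where "monomial_at a \<alpha> = (\<Prod>i\<in>UNIV. (\<alpha> $ i) ^ a i)"

text \<open>The tensor product of the k-th and the l-th symmetric powers of R^n, as the space of
  polynomials that are bihomogeneous of degree (k, l).\<close>

definition bihomogeneous :: "nat \<Rightarrow> nat \<Rightarrow> 'n::finite bipoly set"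
  where "bihomogeneous k l =
    {p. \<exists>c. p = (\<lambda>\<alpha> \<beta>. \<Sum>a\<in>multi_indices k. \<Sum>b\<in>multi_indices l.
                   c a b * monomial_at a \<alpha> * monomial_at b \<beta>)}"

text \<open>The operator \<open>\<alpha>\<^sub>i D\<^bsub>\<alpha>\<^sub>j\<^esub> + \<beta>\<^sub>i D\<^bsub>\<beta>\<^sub>j\<^esub>\<close>, i.e. the action of the elementary matrix
  with entry 1 in row i and column j (which maps the j-th basis vector of R^n to the i-th one).\<close>

definition polarization :: "'n \<Rightarrow> 'n \<Rightarrow> 'n::finite bipoly \<Rightarrow> 'n bipoly"
  where "polarization i j p \<alpha> \<beta> =
    \<alpha> $ i * pderivative j (\<lambda>\<alpha>'. p \<alpha>' \<beta>) \<alpha> + \<beta> $ i * pderivative j (\<lambda>\<beta>'. p \<alpha> \<beta>') \<beta>"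

definition gl_action :: "real ^ 'n ^ 'n \<Rightarrow> 'n::finite bipoly \<Rightarrow> 'n bipoly"
  where "gl_action A p \<alpha> \<beta> = (\<Sum>i\<in>UNIV. \<Sum>j\<in>UNIV. A $ i $ j * polarization i j p \<alpha> \<beta>)"

definition gl_submodule :: "nat \<Rightarrow> nat \<Rightarrow> 'n::finite bipoly set \<Rightarrow> bool"
  where "gl_submodule k l W \<longleftrightarrow>
    W \<subseteq> bihomogeneous k l \<and>
    (\<lambda>\<alpha> \<beta>. 0) \<in> W \<and>
    (\<forall>p\<in>W. \<forall>r\<in>W. (\<lambda>\<alpha> \<beta>. p \<alpha> \<beta> + r \<alpha> \<beta>) \<in> W) \<and>
    (\<forall>c. \<forall>p\<in>W. (\<lambda>\<alpha> \<beta>. c * p \<alpha> \<beta>) \<in> W) \<and>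
    (\<forall>A. \<forall>p\<in>W. gl_action A p \<in> W)"

definition irreducible_gl_submodule :: "nat \<Rightarrow> nat \<Rightarrow> 'n::finite bipoly set \<Rightarrow> bool"
  where "irreducible_gl_submodule k l W \<longleftrightarrow>
    gl_submodule k l W \<and> W \<noteq> {\<lambda>\<alpha> \<beta>. 0} \<and>
    (\<forall>U. gl_submodule k l U \<and> U \<subseteq> W \<longrightarrow> U = {\<lambda>\<alpha> \<beta>. 0} \<or> U = W)"

text \<open>Two distinct elements \<open>i1\<close>, \<open>i2\<close> of \<open>'n\<close> play the role of the first two indices 1 and 2.\<close>

definition highest_weight_vector :: "'n \<Rightarrow> 'n \<Rightarrow> nat \<Rightarrow> nat \<Rightarrow> nat \<Rightarrow> 'n::finite bipoly"
  where "highest_weight_vector i1 i2 k l q \<alpha> \<beta> =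
    (\<alpha> $ i1 * \<beta> $ i2 - \<alpha> $ i2 * \<beta> $ i1) ^ q * (\<alpha> $ i1) ^ (k - q) * (\<beta> $ i1) ^ (l - q)"

text \<open>The module generated by the highest weight vector. The lemma \<open>V_module_unique\<close> below shows
  that an irreducible submodule containing this vector can only be \<open>V_module\<close>.\<close>

definition V_module :: "'n \<Rightarrow> 'n \<Rightarrow> nat \<Rightarrow> nat \<Rightarrow> nat \<Rightarrow> 'n::finite bipoly set"
  where "V_module i1 i2 k l q =
    \<Inter>{W. gl_submodule k l W \<and> highest_weight_vector i1 i2 k l q \<in> W}"

lemma highest_weight_vector_nonzero:
  assumes "i1 \<noteq> i2"
  shows "highest_weight_vector i1 i2 k l q \<noteq> (\<lambda>\<alpha> \<beta>. 0)"
proof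
  assume "highest_weight_vector i1 i2 k l q = (\<lambda>\<alpha> \<beta>. 0)"
  then have "highest_weight_vector i1 i2 k l q (axis i1 1) (axis i1 1 + axis i2 1) = 0"
    by simp
  with assms show False
    by (simp add: highest_weight_vector_def axis_def)
qed

lemma V_module_unique:
  assumes "i1 \<noteq> i2" and W: "irreducible_gl_submodule k l W"
    and v: "highest_weight_vector i1 i2 k l q \<in> W"
  shows "W = V_module i1 i2 k l q"
proof -
  have sub: "gl_submodule k l W"
    using W by (simp add: irreducible_gl_submodule_def)
  have le: "V_module i1 i2 k l q \<subseteq> W"
    using sub v by (auto simp: V_module_def)
  then have "V_module i1 i2 k l q \<subseteq> bihomogeneous k l"
    using sub by (auto simp: gl_submodule_def)
  then have "gl_submodule k l (V_module i1 i2 k l q)"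
    unfolding gl_submodule_def by (auto simp: V_module_def gl_submodule_def)
  moreover have "highest_weight_vector i1 i2 k l q \<in> V_module i1 i2 k l q"
    by (simp add: V_module_def)
  ultimately show ?thesis
    using W le highest_weight_vector_nonzero[OF assms(1)]
    unfolding irreducible_gl_submodule_def by blast
qed


subsection \<open>Symbols\<close>

type_synonym 'n symbol = "real ^ 'n \<Rightarrow> 'n bipoly"

definition bihomogeneous_symbols :: "nat \<Rightarrow> nat \<Rightarrow> 'n::finite symbol set"
  where "bihomogeneous_symbols k l =
    {P. \<exists>c. (\<forall>a b. smooth (c a b)) \<and>
            P = (\<lambda>x \<alpha> \<beta>. \<Sum>a\<in>multi_indices k. \<Sum>b\<in>multi_indices l.
                   c a b x * monomial_at a \<alpha> * monomial_at b \<beta>)}"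

definition symbols :: "'n \<Rightarrow> 'n \<Rightarrow> nat \<Rightarrow> nat \<Rightarrow> nat \<Rightarrow> 'n::finite symbol set"
  where "symbols i1 i2 k l q =
    {P \<in> bihomogeneous_symbols k l. \<forall>x. P x \<in> V_module i1 i2 k l q}"

definition lie :: "real \<Rightarrow> (real ^ 'n \<Rightarrow> real ^ 'n) \<Rightarrow> 'n::finite symbol \<Rightarrow> 'n symbol"
  where "lie \<delta> X P x \<alpha> \<beta> =
    (\<Sum>i\<in>UNIV. X x $ i * pderivative i (\<lambda>y. P y \<alpha> \<beta>) x)
    - (\<Sum>i\<in>UNIV. \<Sum>j\<in>UNIV. pderivative j (\<lambda>y. X y $ i) x * polarization i j (P x) \<alpha> \<beta>)
    + \<delta> * (\<Sum>i\<in>UNIV. pderivative i (\<lambda>y. X y $ i) x) * P x \<alpha> \<beta>"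


subsection \<open>The Casimir operator\<close>

text \<open>The dual basis is \<open>fld_e j i\<close> for \<open>fld_e i j\<close>, \<open>fld_diag_dual i\<close> for \<open>fld_diag i\<close>,
  \<open>fld_quad i\<close> for \<open>fld_const i\<close> and vice versa.\<close>

definition fld_e :: "'n \<Rightarrow> 'n \<Rightarrow> real ^ 'n \<Rightarrow> real ^ 'n"
  where "fld_e i j x = - (x $ j) *\<^sub>R axis i 1"

definition fld_diag :: "'n \<Rightarrow> real ^ 'n \<Rightarrow> real ^ 'n"
  where "fld_diag i x = - (x $ i) *\<^sub>R axis i 1 - x"

definition fld_diag_dual :: "'n \<Rightarrow> real ^ 'n \<Rightarrow> real ^ 'n"
  where "fld_diag_dual i x = - (x $ i) *\<^sub>R axis i 1"

definition fld_const :: "'n \<Rightarrow> real ^ 'n \<Rightarrow> real ^ 'n"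
  where "fld_const i x = - axis i 1"

definition fld_quad :: "'n \<Rightarrow> real ^ 'n \<Rightarrow> real ^ 'n"
  where "fld_quad i x = (x $ i) *\<^sub>R x"

definition casimir :: "real \<Rightarrow> 'n::finite symbol \<Rightarrow> 'n symbol"
  where "casimir \<delta> P x \<alpha> \<beta> =
    (\<Sum>i\<in>UNIV. \<Sum>j\<in>UNIV - {i}. lie \<delta> (fld_e i j) (lie \<delta> (fld_e j i) P) x \<alpha> \<beta>)
    + (\<Sum>i\<in>UNIV.
          lie \<delta> (fld_diag i) (lie \<delta> (fld_diag_dual i) P) x \<alpha> \<beta>
        + lie \<delta> (fld_const i) (lie \<delta> (fld_quad i) P) x \<alpha> \<beta>
        + lie \<delta> (fld_quad i) (lie \<delta> (fld_const i) P) x \<alpha> \<beta>)"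

end

theory Submission
  imports Defs
begin

text \<open>
  Write \<open>E\<^bsub>ij\<^esub>\<close> for \<open>polarization i j\<close>, \<open>n\<close> for the dimension and \<open>d = k + l\<close>.

  The Casimir operator commutes with the translations, so one expects it to be determined by its
  value at the origin, where the linear and quadratic fields vanish. This is what the expansion in
  \<open>casimir_pointwise\<close> shows: all terms with a derivative in \<open>x\<close> cancel, and with
  \<open>A\<^bsub>ij\<^esub> = E\<^bsub>ij\<^esub> - \<delta>\<close> if \<open>i = j\<close> and \<open>A\<^bsub>ij\<^esub> = E\<^bsub>ij\<^esub>\<close> otherwise, the operator acts on the polynomial
  \<open>P x\<close> by \<open>\<Sum> A\<^bsub>ij\<^esub> A\<^bsub>ji\<^esub> + (\<Sum> A\<^bsub>ii\<^esub>)\<^sup>2 + (n + 1) \<Sum> A\<^bsub>ii\<^esub>\<close>. The cancellation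
  rests on the fact that differentiation in \<open>x\<close> commutes with the \<open>E\<^bsub>ij\<^esub>\<close>.

  By Euler's identity (\<open>polarization_euler\<close>) the trace \<open>\<Sum> E\<^bsub>ii\<^esub>\<close> is multiplication by \<open>d\<close>, so that up
  to explicit scalars only the Casimir operator \<open>\<Sum> E\<^bsub>ij\<^esub> E\<^bsub>ji\<^esub>\<close> of gl is left
  (\<open>weighted_casimir\<close>). It commutes with the action (\<open>gl_casimir_commutes\<close>), so its eigenspaces are
  submodules, and on the module generated by the highest weight vector it has the eigenvalue of
  that vector, of weight \<open>(d - q, q, 0, \<dots>, 0)\<close>:
  \<open>(d - q) (d - q + n - 1) + q (q + n - 3)\<close> (\<open>gl_casimir_highest_weight_vector\<close>). Adding the
  scalars gives the formula.
\<close>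

section \<open>Partial derivatives\<close>

lemma pderivative_works:
  fixes f :: "real ^ 'n::finite \<Rightarrow> real"
  assumes "f differentiable (at x)"
  shows "((\<lambda>t. f (x + t *\<^sub>R axis i 1)) has_real_derivative pderivative i f x) (at 0)"
proof -
  have "(\<lambda>t. x + t *\<^sub>R axis i 1) differentiable (at (0::real))"
    by (intro derivative_intros)
  moreover have "f differentiable (at (x + 0 *\<^sub>R axis i 1))"
    using assms by simp
  ultimately have "(f \<circ> (\<lambda>t. x + t *\<^sub>R axis i 1)) differentiable (at (0::real))"
    by (rule differentiable_chain_at)
  then have "(\<lambda>t. f (x + t *\<^sub>R axis i 1)) differentiable (at (0::real))"
    by (simp add: o_def)
  then show ?thesis
    unfolding pderivative_def by (simp add: DERIV_deriv_iff_real_differentiable)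
qed

lemma pderivative_const [simp]: "pderivative i (\<lambda>x. c) x = 0"
  by (simp add: pderivative_def)

lemma pderivative_coord [simp]: "pderivative i (\<lambda>x. x $ j) x = (if i = j then 1 else 0)"
proof -
  have "((\<lambda>t. (x + t *\<^sub>R axis i 1) $ j) has_real_derivative (if i = j then 1 else 0)) (at 0)"
    by (auto simp: axis_def intro!: derivative_eq_intros)
  then show ?thesis unfolding pderivative_def by (rule DERIV_imp_deriv)
qed

lemma pderivative_add:
  assumes "f differentiable (at x)" "g differentiable (at x)"
  shows "pderivative i (\<lambda>y. f y + g y) x = pderivative i f x + pderivative i g x"
  using DERIV_add[OF assms[THEN pderivative_works[where i = i]]]
  by (subst pderivative_def) (rule DERIV_imp_deriv)

lemma pderivative_mult:
  assumes "f differentiable (at x)" "g differentiable (at x)"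
  shows "pderivative i (\<lambda>y. f y * g y) x = pderivative i f x * g x + f x * pderivative i g x"
  using DERIV_mult[OF assms[THEN pderivative_works[where i = i]]]
  by (subst pderivative_def) (auto intro!: DERIV_imp_deriv simp: mult.commute)

lemma pderivative_cmult:
  assumes "f differentiable (at x)"
  shows "pderivative i (\<lambda>y. c * f y) x = c * pderivative i f x"
  using pderivative_mult[OF differentiable_const assms, of i c] by simp

lemma pderivative_diff:
  assumes "f differentiable (at x)" "g differentiable (at x)"
  shows "pderivative i (\<lambda>y. f y - g y) x = pderivative i f x - pderivative i g x"
  using DERIV_diff[OF assms[THEN pderivative_works[where i = i]]]
  by (subst pderivative_def) (rule DERIV_imp_deriv)

lemma pderivative_sum:
  assumes "\<And>s. s \<in> S \<Longrightarrow> f s differentiable (at x)"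
  shows "pderivative i (\<lambda>y. \<Sum>s\<in>S. f s y) x = (\<Sum>s\<in>S. pderivative i (f s) x)"
  using DERIV_sum[OF assms[THEN pderivative_works[where i = i]]]
  by (subst pderivative_def) (rule DERIV_imp_deriv)

lemma differentiable_coord [simp]: "(\<lambda>x. x $ i) differentiable F"
  by (rule bounded_linear_imp_differentiable[OF bounded_linear_vec_nth])

lemma smooth_differentiable: "smooth f \<Longrightarrow> f differentiable (at x)"
  unfolding smooth_def by (metis Ck.simps(2))

lemma smooth_pderivative: "smooth f \<Longrightarrow> smooth (pderivative i f)"
  unfolding smooth_def by (metis Ck.simps(2))


section \<open>The action of elementary matrices is by derivations\<close>

text \<open>
  The regularity under which \<open>polarization\<close>, which differentiates in one covector at a time, is
  linear and satisfies the Leibniz rule.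
\<close>

definition separately_differentiable :: "'n::finite bipoly \<Rightarrow> bool"
  where "separately_differentiable p \<longleftrightarrow>
    (\<forall>\<alpha> \<beta>. (\<lambda>\<alpha>'. p \<alpha>' \<beta>) differentiable (at \<alpha>) \<and> (\<lambda>\<beta>'. p \<alpha> \<beta>') differentiable (at \<beta>))"

lemma separately_differentiable_add [simp]:
  "separately_differentiable p \<Longrightarrow> separately_differentiable r \<Longrightarrow>
    separately_differentiable (\<lambda>\<alpha> \<beta>. p \<alpha> \<beta> + r \<alpha> \<beta>)"
  by (simp add: separately_differentiable_def)

lemma separately_differentiable_diff [simp]:
  "separately_differentiable p \<Longrightarrow> separately_differentiable r \<Longrightarrow>
    separately_differentiable (\<lambda>\<alpha> \<beta>. p \<alpha> \<beta> - r \<alpha> \<beta>)"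
  by (simp add: separately_differentiable_def)

lemma separately_differentiable_mult [simp]:
  "separately_differentiable p \<Longrightarrow> separately_differentiable r \<Longrightarrow>
    separately_differentiable (\<lambda>\<alpha> \<beta>. p \<alpha> \<beta> * r \<alpha> \<beta>)"
  by (simp add: separately_differentiable_def)

lemma separately_differentiable_const [simp]: "separately_differentiable (\<lambda>\<alpha> \<beta>. c)"
  by (simp add: separately_differentiable_def)

lemma separately_differentiable_sum [simp]:
  "(\<And>s. s \<in> S \<Longrightarrow> separately_differentiable (p s)) \<Longrightarrow>
    separately_differentiable (\<lambda>\<alpha> \<beta>. \<Sum>s\<in>S. p s \<alpha> \<beta>)"
  by (induction S rule: infinite_finite_induct) auto

lemma polarization_const [simp]: "polarization i j (\<lambda>\<alpha> \<beta>. c) = (\<lambda>\<alpha> \<beta>. 0)"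
  by (simp add: fun_eq_iff polarization_def)

lemma polarization_fst [simp]:
  "polarization i j (\<lambda>\<alpha> \<beta>. \<alpha> $ k) = (\<lambda>\<alpha> \<beta>. if j = k then \<alpha> $ i else 0)"
  by (simp add: fun_eq_iff polarization_def)

lemma polarization_snd [simp]:
  "polarization i j (\<lambda>\<alpha> \<beta>. \<beta> $ k) = (\<lambda>\<alpha> \<beta>. if j = k then \<beta> $ i else 0)"
  by (simp add: fun_eq_iff polarization_def)

lemma polarization_add:
  assumes "separately_differentiable p" "separately_differentiable r"
  shows "polarization i j (\<lambda>\<alpha> \<beta>. p \<alpha> \<beta> + r \<alpha> \<beta>) =
    (\<lambda>\<alpha> \<beta>. polarization i j p \<alpha> \<beta> + polarization i j r \<alpha> \<beta>)"
  using assms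
  by (simp add: fun_eq_iff polarization_def separately_differentiable_def pderivative_add
      algebra_simps)

lemma polarization_diff:
  assumes "separately_differentiable p" "separately_differentiable r"
  shows "polarization i j (\<lambda>\<alpha> \<beta>. p \<alpha> \<beta> - r \<alpha> \<beta>) =
    (\<lambda>\<alpha> \<beta>. polarization i j p \<alpha> \<beta> - polarization i j r \<alpha> \<beta>)"
  using assms
  by (simp add: fun_eq_iff polarization_def separately_differentiable_def pderivative_diff
      algebra_simps)

lemma polarization_mult:
  assumes "separately_differentiable p" "separately_differentiable r"
  shows "polarization i j (\<lambda>\<alpha> \<beta>. p \<alpha> \<beta> * r \<alpha> \<beta>) =
    (\<lambda>\<alpha> \<beta>. polarization i j p \<alpha> \<beta> * r \<alpha> \<beta> + p \<alpha> \<beta> * polarization i j r \<alpha> \<beta>)"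
  using assms
  by (simp add: fun_eq_iff polarization_def separately_differentiable_def pderivative_mult
      algebra_simps)

lemma polarization_cmult:
  assumes "separately_differentiable p"
  shows "polarization i j (\<lambda>\<alpha> \<beta>. c * p \<alpha> \<beta>) = (\<lambda>\<alpha> \<beta>. c * polarization i j p \<alpha> \<beta>)"
  using assms
  by (simp add: fun_eq_iff polarization_def separately_differentiable_def pderivative_cmult
      algebra_simps)

lemma polarization_sum:
  assumes "\<And>s. s \<in> S \<Longrightarrow> separately_differentiable (p s)"
  shows "polarization i j (\<lambda>\<alpha> \<beta>. \<Sum>s\<in>S. p s \<alpha> \<beta>) =
    (\<lambda>\<alpha> \<beta>. \<Sum>s\<in>S. polarization i j (p s) \<alpha> \<beta>)"
  using assms
  by (simp add: fun_eq_iff polarization_def separately_differentiable_def pderivative_sum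
      sum_distrib_left sum.distrib)


section \<open>The bigraded algebra of polynomials\<close>

text \<open>
  The bihomogeneous polynomials, presented as the bigraded algebra generated by the constants and
  the coordinates. A derivation is determined by its values on generators, so induction over this
  presentation reduces the commutation relations and Euler's identity to the coordinates. Zero is
  put into every degree so that each component is closed under empty sums.
\<close>

inductive bihom_poly :: "nat \<Rightarrow> nat \<Rightarrow> 'n::finite bipoly \<Rightarrow> bool"
  where
    zero: "bihom_poly k l (\<lambda>\<alpha> \<beta>. 0)"
  | const: "bihom_poly 0 0 (\<lambda>\<alpha> \<beta>. c)"
  | fst: "bihom_poly (Suc 0) 0 (\<lambda>\<alpha> \<beta>. \<alpha> $ i)"
  | snd: "bihom_poly 0 (Suc 0) (\<lambda>\<alpha> \<beta>. \<beta> $ i)"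
  | add: "bihom_poly k l p \<Longrightarrow> bihom_poly k l r \<Longrightarrow> bihom_poly k l (\<lambda>\<alpha> \<beta>. p \<alpha> \<beta> + r \<alpha> \<beta>)"
  | mult: "bihom_poly k l p \<Longrightarrow> bihom_poly k' l' r \<Longrightarrow>
      bihom_poly (k + k') (l + l') (\<lambda>\<alpha> \<beta>. p \<alpha> \<beta> * r \<alpha> \<beta>)"

lemma bihom_poly_cmult:
  assumes "bihom_poly k l p"
  shows "bihom_poly k l (\<lambda>\<alpha> \<beta>. c * p \<alpha> \<beta>)"
  using bihom_poly.mult[OF bihom_poly.const[of c] assms] by simp

lemma bihom_poly_diff:
  assumes "bihom_poly k l p" "bihom_poly k l r"
  shows "bihom_poly k l (\<lambda>\<alpha> \<beta>. p \<alpha> \<beta> - r \<alpha> \<beta>)"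
  using bihom_poly.add[OF assms(1) bihom_poly_cmult[OF assms(2), of "-1"]] by simp

lemma bihom_poly_sum:
  assumes "\<And>s. s \<in> S \<Longrightarrow> bihom_poly k l (p s)"
  shows "bihom_poly k l (\<lambda>\<alpha> \<beta>. \<Sum>s\<in>S. p s \<alpha> \<beta>)"
  using assms
  by (induction S rule: infinite_finite_induct) (auto intro: bihom_poly.zero bihom_poly.add)

lemma bihom_poly_power:
  assumes "bihom_poly k l p"
  shows "bihom_poly (m * k) (m * l) (\<lambda>\<alpha> \<beta>. p \<alpha> \<beta> ^ m)"
proof (induction m)
  case 0
  show ?case using bihom_poly.const[of 1] by simp
next
  case (Suc m)
  show ?case using bihom_poly.mult[OF assms Suc] by simp
qed

lemma bihom_poly_separately_differentiable:
  "bihom_poly k l p \<Longrightarrow> separately_differentiable p"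
  by (induction rule: bihom_poly.induct) (auto simp: separately_differentiable_def)

lemma bihom_poly_polarization:
  "bihom_poly k l p \<Longrightarrow> bihom_poly k l (polarization i j p)"
proof (induction rule: bihom_poly.induct)
  case (fst m)
  show ?case by (cases "j = m") (auto intro: bihom_poly.intros)
next
  case (snd m)
  show ?case by (cases "j = m") (auto intro: bihom_poly.intros)
next
  case (add k l p r)
  then show ?case by (simp add: polarization_add bihom_poly_separately_differentiable bihom_poly.add)
next
  case (mult k l p k' l' r)
  then show ?case
    by (simp add: polarization_mult bihom_poly_separately_differentiable) (intro bihom_poly.add bihom_poly.mult)
qed (simp_all add: bihom_poly.zero)

lemma bihom_poly_sd:
  assumes "bihom_poly k l p"
  shows "separately_differentiable p" "separately_differentiable (polarization i j p)"
    "separately_differentiable (polarization i j (polarization i' j' p))"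
  using assms by (auto intro: bihom_poly_separately_differentiable bihom_poly_polarization)

text \<open>
  The bracket \<open>[E\<^bsub>ij\<^esub>, E\<^bsub>ab\<^esub>] = \<delta>\<^bsub>ja\<^esub> E\<^bsub>ib\<^esub> - \<delta>\<^bsub>bi\<^esub> E\<^bsub>aj\<^esub>\<close> of elementary matrices. Both
  sides are derivations, so they agree everywhere once they agree on the coordinates.
\<close>

lemma polarization_commutator:
  "bihom_poly k l p \<Longrightarrow>
    polarization i j (polarization a b p) \<alpha> \<beta> =
    polarization a b (polarization i j p) \<alpha> \<beta>
      + (if a = j then polarization i b p \<alpha> \<beta> else 0)
      - (if b = i then polarization a j p \<alpha> \<beta> else 0)"
proof (induction arbitrary: \<alpha> \<beta> rule: bihom_poly.induct)
  case (fst m)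
  show ?case by (cases "j = m"; cases "b = m"; auto)
next
  case (snd m)
  show ?case by (cases "j = m"; cases "b = m"; auto)
next
  case (add k l p r)
  then show ?case
    by (simp add: polarization_add bihom_poly_sd)
next
  case (mult k l p k' l' r)
  note sd = bihom_poly_sd[OF mult.hyps(1)] bihom_poly_sd[OF mult.hyps(2)]
  have second: "polarization i' j' (polarization a' b' (\<lambda>\<alpha> \<beta>. p \<alpha> \<beta> * r \<alpha> \<beta>)) \<alpha> \<beta> =
      polarization i' j' (polarization a' b' p) \<alpha> \<beta> * r \<alpha> \<beta>
      + polarization a' b' p \<alpha> \<beta> * polarization i' j' r \<alpha> \<beta>
      + polarization i' j' p \<alpha> \<beta> * polarization a' b' r \<alpha> \<beta>
      + p \<alpha> \<beta> * polarization i' j' (polarization a' b' r) \<alpha> \<beta>" for i' j' a' b'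
    by (simp add: polarization_mult polarization_add sd)
  show ?case
    unfolding second mult.IH by (simp add: polarization_mult sd algebra_simps)
qed simp_all

text \<open>
  Euler's identity: the trace of the action is the sum of the Euler operators in \<open>\<alpha>\<close> and \<open>\<beta>\<close>,
  which is the derivation multiplying each coordinate by 1.
\<close>

lemma polarization_euler:
  fixes p :: "'n::finite bipoly"
  shows "bihom_poly k l p \<Longrightarrow>
    (\<Sum>i\<in>UNIV. polarization i i p \<alpha> \<beta>) = (real k + real l) * p \<alpha> \<beta>"
proof (induction arbitrary: \<alpha> \<beta> rule: bihom_poly.induct)
  case (add k l p r)
  then show ?case
    by (simp add: polarization_add bihom_poly_sd sum.distrib algebra_simps)
next
  case (mult k l p k' l' r)
  then show ?case
    by (simp add: polarization_mult bihom_poly_sd sum.distrib algebra_simps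
        flip: sum_distrib_left sum_distrib_right)
qed simp_all


section \<open>Comparison with sums of monomials\<close>

lemma finite_multi_indices: "finite (multi_indices k :: ('n::finite \<Rightarrow> nat) set)"
proof (rule finite_subset)
  show "multi_indices k \<subseteq> {f :: 'n \<Rightarrow> nat. \<forall>i. f i \<in> {..k}}"
    by (auto simp: multi_indices_def intro: member_le_sum)
  show "finite {f :: 'n \<Rightarrow> nat. \<forall>i. f i \<in> {..k}}"
    using finite_set_of_finite_funs[of "UNIV :: 'n set" "{..k}" undefined] by simp
qed

lemma bihom_poly_monomial_fst:
  fixes a :: "'n::finite \<Rightarrow> nat"
  shows "bihom_poly (\<Sum>i\<in>UNIV. a i) 0 (\<lambda>\<alpha> \<beta>. monomial_at a \<alpha>)"
proof -
  have "bihom_poly (\<Sum>i\<in>S. a i) 0 (\<lambda>\<alpha> \<beta>. \<Prod>i\<in>S. \<alpha> $ i ^ a i)" for S :: "'n set"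
  proof (induction S rule: infinite_finite_induct)
    case (insert s S)
    have "bihom_poly (a s) 0 (\<lambda>\<alpha> \<beta>. \<alpha> $ s ^ a s)"
      using bihom_poly_power[OF bihom_poly.fst] by simp
    from bihom_poly.mult[OF this insert.IH] show ?case using insert.hyps by simp
  qed (auto intro: bihom_poly.const)
  then show ?thesis by (simp add: monomial_at_def)
qed

lemma bihom_poly_monomial_snd:
  fixes a :: "'n::finite \<Rightarrow> nat"
  shows "bihom_poly 0 (\<Sum>i\<in>UNIV. a i) (\<lambda>\<alpha> \<beta>. monomial_at a \<beta>)"
proof -
  have "bihom_poly 0 (\<Sum>i\<in>S. a i) (\<lambda>\<alpha> \<beta>. \<Prod>i\<in>S. \<beta> $ i ^ a i)" for S :: "'n set"
  proof (induction S rule: infinite_finite_induct)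
    case (insert s S)
    have "bihom_poly 0 (a s) (\<lambda>\<alpha> \<beta>. \<beta> $ s ^ a s)"
      using bihom_poly_power[OF bihom_poly.snd] by simp
    from bihom_poly.mult[OF this insert.IH] show ?case using insert.hyps by simp
  qed (auto intro: bihom_poly.const)
  then show ?thesis by (simp add: monomial_at_def)
qed

lemma bihom_poly_monomial:
  assumes "a \<in> multi_indices k" "b \<in> multi_indices l"
  shows "bihom_poly k l (\<lambda>\<alpha> \<beta>. monomial_at a \<alpha> * monomial_at b \<beta>)"
  using bihom_poly.mult[OF bihom_poly_monomial_fst[of a] bihom_poly_monomial_snd[of b]] assms
  by (simp add: multi_indices_def)

lemma bihomogeneous_imp_bihom_poly:
  assumes "p \<in> bihomogeneous k l"
  shows "bihom_poly k l p"
  using assms unfolding bihomogeneous_def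
  by (auto simp: mult.assoc intro!: bihom_poly_sum bihom_poly_cmult bihom_poly_monomial)

lemma bihomogeneous_add:
  assumes "p \<in> bihomogeneous k l" "r \<in> bihomogeneous k l"
  shows "(\<lambda>\<alpha> \<beta>. p \<alpha> \<beta> + r \<alpha> \<beta>) \<in> bihomogeneous k l"
proof -
  obtain c d where "p = (\<lambda>\<alpha> \<beta>. \<Sum>a\<in>multi_indices k. \<Sum>b\<in>multi_indices l.
      c a b * monomial_at a \<alpha> * monomial_at b \<beta>)"
    "r = (\<lambda>\<alpha> \<beta>. \<Sum>a\<in>multi_indices k. \<Sum>b\<in>multi_indices l.
      d a b * monomial_at a \<alpha> * monomial_at b \<beta>)"
    using assms by (auto simp: bihomogeneous_def)
  then have "(\<lambda>\<alpha> \<beta>. p \<alpha> \<beta> + r \<alpha> \<beta>) = (\<lambda>\<alpha> \<beta>. \<Sum>a\<in>multi_indices k. \<Sum>b\<in>multi_indices l.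
      (c a b + d a b) * monomial_at a \<alpha> * monomial_at b \<beta>)"
    by (simp add: sum.distrib distrib_right)
  then show ?thesis
    unfolding bihomogeneous_def by (auto intro!: exI[of _ "\<lambda>a b. c a b + d a b"])
qed

lemma bihomogeneous_zero: "(\<lambda>\<alpha> \<beta>. 0) \<in> bihomogeneous k l"
  unfolding bihomogeneous_def by (auto intro!: exI[of _ "\<lambda>a b. 0"])

lemma bihomogeneous_sum:
  assumes "\<And>s. s \<in> S \<Longrightarrow> p s \<in> bihomogeneous k l"
  shows "(\<lambda>\<alpha> \<beta>. \<Sum>s\<in>S. p s \<alpha> \<beta>) \<in> bihomogeneous k l"
  using assms
  by (induction S rule: infinite_finite_induct) (auto intro: bihomogeneous_zero bihomogeneous_add)

lemma bihomogeneous_monomial: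
  assumes "a \<in> multi_indices k" "b \<in> multi_indices l"
  shows "(\<lambda>\<alpha> \<beta>. c * monomial_at a \<alpha> * monomial_at b \<beta>) \<in> bihomogeneous k l"
proof -
  have inner: "(\<Sum>b'\<in>multi_indices l.
      (if a' = a then if b' = b then c else 0 else 0) * monomial_at a' \<alpha> * monomial_at b' \<beta>) =
      (if a' = a then c * monomial_at a \<alpha> * monomial_at b \<beta> else 0)" for a' \<alpha> \<beta>
    using assms by (simp add: if_distrib[of "\<lambda>u. u * _"] sum.delta finite_multi_indices
        cong: if_cong)
  have "(\<lambda>\<alpha> \<beta>. \<Sum>a'\<in>multi_indices k. \<Sum>b'\<in>multi_indices l.
      (if a' = a then if b' = b then c else 0 else 0) * monomial_at a' \<alpha> * monomial_at b' \<beta>) =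
      (\<lambda>\<alpha> \<beta>. c * monomial_at a \<alpha> * monomial_at b \<beta>)"
    unfolding inner using assms by (simp add: finite_multi_indices)
  then show ?thesis
    unfolding bihomogeneous_def
    by (auto intro!: exI[of _ "\<lambda>a' b'. if a' = a then if b' = b then c else 0 else 0"])
qed

lemma monomial_at_mult:
  "monomial_at a \<alpha> * monomial_at b \<alpha> = monomial_at (\<lambda>i. a i + b i) \<alpha>"
  by (simp add: monomial_at_def power_add prod.distrib)

lemma bihomogeneous_mult:
  assumes "p \<in> bihomogeneous k l" "r \<in> bihomogeneous k' l'"
  shows "(\<lambda>\<alpha> \<beta>. p \<alpha> \<beta> * r \<alpha> \<beta>) \<in> bihomogeneous (k + k') (l + l')"
proof -
  obtain c d where p: "p = (\<lambda>\<alpha> \<beta>. \<Sum>a\<in>multi_indices k. \<Sum>b\<in>multi_indices l.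
      c a b * monomial_at a \<alpha> * monomial_at b \<beta>)"
    and r: "r = (\<lambda>\<alpha> \<beta>. \<Sum>a\<in>multi_indices k'. \<Sum>b\<in>multi_indices l'.
      d a b * monomial_at a \<alpha> * monomial_at b \<beta>)"
    using assms by (auto simp: bihomogeneous_def)
  have "(\<lambda>\<alpha> \<beta>. p \<alpha> \<beta> * r \<alpha> \<beta>) = (\<lambda>\<alpha> \<beta>. \<Sum>a\<in>multi_indices k. \<Sum>a'\<in>multi_indices k'.
      \<Sum>b\<in>multi_indices l. \<Sum>b'\<in>multi_indices l'.
      c a b * d a' b' * monomial_at (\<lambda>i. a i + a' i) \<alpha> * monomial_at (\<lambda>i. b i + b' i) \<beta>)"
    by (simp add: p r sum_product flip: monomial_at_mult) (simp add: mult_ac)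
  also have "\<dots> \<in> bihomogeneous (k + k') (l + l')"
    by (intro bihomogeneous_sum bihomogeneous_monomial)
      (auto simp: multi_indices_def sum.distrib)
  finally show ?thesis .
qed

lemma bihom_poly_imp_bihomogeneous:
  "bihom_poly k l p \<Longrightarrow> p \<in> bihomogeneous k l"
proof (induction rule: bihom_poly.induct)
  case (const c)
  show ?case
    using bihomogeneous_monomial[of "\<lambda>_. 0" 0 "\<lambda>_. 0" 0 c]
    by (simp add: multi_indices_def monomial_at_def)
next
  case (fst i)
  have "monomial_at (\<lambda>j. if j = i then 1 else 0) \<alpha> = \<alpha> $ i" for \<alpha> :: "real ^ 'a"
    by (simp add: monomial_at_def if_distrib[of "\<lambda>e. _ ^ e"] prod.delta cong: if_cong)
  then show ?case
    using bihomogeneous_monomial[of "\<lambda>j. if j = i then 1 else 0" "Suc 0" "\<lambda>_. 0" 0 1]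
    by (simp add: multi_indices_def) (simp add: monomial_at_def)
next
  case (snd i)
  have "monomial_at (\<lambda>j. if j = i then 1 else 0) \<alpha> = \<alpha> $ i" for \<alpha> :: "real ^ 'a"
    by (simp add: monomial_at_def if_distrib[of "\<lambda>e. _ ^ e"] prod.delta cong: if_cong)
  then show ?case
    using bihomogeneous_monomial[of "\<lambda>_. 0" 0 "\<lambda>j. if j = i then 1 else 0" "Suc 0" 1]
    by (simp add: multi_indices_def) (simp add: monomial_at_def)
qed (auto intro: bihomogeneous_zero bihomogeneous_add bihomogeneous_mult)

lemma bihomogeneous_iff_bihom_poly: "p \<in> bihomogeneous k l \<longleftrightarrow> bihom_poly k l p"
  using bihomogeneous_imp_bihom_poly bihom_poly_imp_bihomogeneous by blast


section \<open>The Casimir operator of gl\<close>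

definition gl_casimir :: "'n::finite bipoly \<Rightarrow> 'n bipoly"
  where "gl_casimir p \<alpha> \<beta> = (\<Sum>i\<in>UNIV. \<Sum>j\<in>UNIV. polarization i j (polarization j i p) \<alpha> \<beta>)"

lemma gl_casimir_zero: "gl_casimir (\<lambda>\<alpha> \<beta>. 0) = (\<lambda>\<alpha> \<beta>. 0)"
  by (simp add: fun_eq_iff gl_casimir_def)

lemma gl_casimir_add:
  assumes "bihom_poly k l p" "bihom_poly k l r"
  shows "gl_casimir (\<lambda>\<alpha> \<beta>. p \<alpha> \<beta> + r \<alpha> \<beta>) = (\<lambda>\<alpha> \<beta>. gl_casimir p \<alpha> \<beta> + gl_casimir r \<alpha> \<beta>)"
  using assms
  by (simp add: fun_eq_iff gl_casimir_def polarization_add bihom_poly_sd sum.distrib)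

lemma gl_casimir_cmult:
  assumes "bihom_poly k l p"
  shows "gl_casimir (\<lambda>\<alpha> \<beta>. c * p \<alpha> \<beta>) = (\<lambda>\<alpha> \<beta>. c * gl_casimir p \<alpha> \<beta>)"
  using assms
  by (simp add: fun_eq_iff gl_casimir_def polarization_cmult bihom_poly_sd sum_distrib_left)

lemma sum_if_const: "(\<Sum>j\<in>A. if Q then f j else 0) = (if Q then sum f A else (0 :: real))"
  by simp

text \<open>
  Moving \<open>E\<^bsub>ab\<^esub>\<close> through \<open>E\<^bsub>ij\<^esub> E\<^bsub>ji\<^esub>\<close> produces four correction terms; after summation over \<open>i\<close> and
  \<open>j\<close> they cancel in pairs.
\<close>

lemma gl_casimir_commutes:
  fixes p :: "'n::finite bipoly"
  assumes p: "bihom_poly k l p"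
  shows "gl_casimir (polarization a b p) = polarization a b (gl_casimir p)"
proof (intro ext)
  fix \<alpha> \<beta> :: "real ^ 'n"
  note sd = bihom_poly_sd[OF p]
  have step: "polarization a b (polarization i j (polarization j i p)) \<alpha> \<beta> =
      polarization i j (polarization j i (polarization a b p)) \<alpha> \<beta>
      + (if j = b then polarization i j (polarization a i p) \<alpha> \<beta> else 0)
      - (if i = a then polarization i j (polarization j b p) \<alpha> \<beta> else 0)
      + (if i = b then polarization a j (polarization j i p) \<alpha> \<beta> else 0)
      - (if j = a then polarization i b (polarization j i p) \<alpha> \<beta> else 0)" for i j
  proof -
    have "polarization a b (polarization j i p) = (\<lambda>\<alpha> \<beta>.
        polarization j i (polarization a b p) \<alpha> \<beta>
        + (if j = b then polarization a i p \<alpha> \<beta> else 0)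
        - (if i = a then polarization j b p \<alpha> \<beta> else 0))"
      using polarization_commutator[OF p] by blast
    then have "polarization i j (polarization a b (polarization j i p)) \<alpha> \<beta> =
        polarization i j (polarization j i (polarization a b p)) \<alpha> \<beta>
        + (if j = b then polarization i j (polarization a i p) \<alpha> \<beta> else 0)
        - (if i = a then polarization i j (polarization j b p) \<alpha> \<beta> else 0)"
      by (cases "j = b"; cases "i = a";
          simp add: polarization_add polarization_diff sd)
    then show ?thesis
      using polarization_commutator[OF bihom_poly_polarization[OF p], of a b i j j i \<alpha> \<beta>]
      by simp
  qed
  have "polarization a b (gl_casimir p) \<alpha> \<beta> =
      (\<Sum>i\<in>UNIV. \<Sum>j\<in>UNIV. polarization a b (polarization i j (polarization j i p)) \<alpha> \<beta>)"
    unfolding gl_casimir_def[abs_def]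
    by (simp add: polarization_sum sd)
  also have "\<dots> = gl_casimir (polarization a b p) \<alpha> \<beta>"
    unfolding step gl_casimir_def
    by (simp add: sum.distrib sum_subtractf sum_if_const)
  finally show "gl_casimir (polarization a b p) \<alpha> \<beta> = polarization a b (gl_casimir p) \<alpha> \<beta>" ..
qed


section \<open>The Casimir operator on the module generated by the highest weight vector\<close>

lemma polarization_eigen_mult:
  assumes "separately_differentiable p" "separately_differentiable r"
    and "polarization i j p = (\<lambda>\<alpha> \<beta>. c * p \<alpha> \<beta>)" "polarization i j r = (\<lambda>\<alpha> \<beta>. d * r \<alpha> \<beta>)"
  shows "polarization i j (\<lambda>\<alpha> \<beta>. p \<alpha> \<beta> * r \<alpha> \<beta>) = (\<lambda>\<alpha> \<beta>. (c + d) * (p \<alpha> \<beta> * r \<alpha> \<beta>))"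
  using assms by (simp add: polarization_mult fun_eq_iff algebra_simps)

lemma separately_differentiable_power:
  "separately_differentiable p \<Longrightarrow> separately_differentiable (\<lambda>\<alpha> \<beta>. p \<alpha> \<beta> ^ m)"
  by (induction m) simp_all

lemma polarization_eigen_power:
  assumes "separately_differentiable p"
    and "polarization i j p = (\<lambda>\<alpha> \<beta>. c * p \<alpha> \<beta>)"
  shows "polarization i j (\<lambda>\<alpha> \<beta>. p \<alpha> \<beta> ^ m) = (\<lambda>\<alpha> \<beta>. real m * c * p \<alpha> \<beta> ^ m)"
proof (induction m)
  case (Suc m)
  show ?case
    using polarization_eigen_mult[OF assms(1) separately_differentiable_power[OF assms(1)]
        assms(2) Suc]
    by (simp add: algebra_simps)
qed simp

text \<open>
  The vector is a product of powers of three factors. If a derivation multiplies each factor by a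
  constant, the constants add up with the exponents as multiplicities.
\<close>

lemma polarization_highest_weight_vector:
  assumes "\<And>\<alpha> \<beta>. polarization i j (\<lambda>\<alpha> \<beta>. \<alpha> $ i1 * \<beta> $ i2 - \<alpha> $ i2 * \<beta> $ i1) \<alpha> \<beta> =
      c * (\<alpha> $ i1 * \<beta> $ i2 - \<alpha> $ i2 * \<beta> $ i1)"
    and "\<And>\<alpha> \<beta>. polarization i j (\<lambda>\<alpha> \<beta>. \<alpha> $ i1) \<alpha> \<beta> = d * \<alpha> $ i1"
    and "\<And>\<alpha> \<beta>. polarization i j (\<lambda>\<alpha> \<beta>. \<beta> $ i1) \<alpha> \<beta> = d * \<beta> $ i1"
  shows "polarization i j (highest_weight_vector i1 i2 k l q) =
    (\<lambda>\<alpha> \<beta>. (real q * c + real (k - q) * d + real (l - q) * d) *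
      highest_weight_vector i1 i2 k l q \<alpha> \<beta>)"
proof -
  note sd = bihom_poly.fst[THEN bihom_poly_separately_differentiable]
    bihom_poly.snd[THEN bihom_poly_separately_differentiable]
  show ?thesis
    unfolding highest_weight_vector_def[abs_def]
    by (intro polarization_eigen_mult polarization_eigen_power separately_differentiable_power
        separately_differentiable_mult separately_differentiable_diff sd ext assms)
qed

lemma polarization_determinant:
  "polarization i j (\<lambda>\<alpha> \<beta>. \<alpha> $ a * \<beta> $ b - \<alpha> $ b * \<beta> $ a) \<alpha> \<beta> =
    (if j = a then \<alpha> $ i * \<beta> $ b - \<alpha> $ b * \<beta> $ i else 0)
    + (if j = b then \<alpha> $ a * \<beta> $ i - \<alpha> $ i * \<beta> $ a else 0)"
proof -
  note sd = bihom_poly.fst[THEN bihom_poly_separately_differentiable]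
    bihom_poly.snd[THEN bihom_poly_separately_differentiable]
  show ?thesis
    by (simp add: polarization_diff polarization_mult sd)
qed

text \<open>
  Write \<open>E\<^bsub>ij\<^esub>\<close> for the polarizations. The vector depends only on the components \<open>i1\<close> and \<open>i2\<close>,
  so \<open>E\<^bsub>ji\<^esub>\<close> kills it unless \<open>i\<close> is one of these two. It is also killed by \<open>polarization i1 i2\<close>,
  which replaces the components \<open>i2\<close> by the components \<open>i1\<close> and so turns the determinant into one
  with two equal columns, while the other two factors contain no component \<open>i2\<close>. The surviving terms
  \<open>E\<^bsub>ij\<^esub> E\<^bsub>ji\<^esub> v\<close> with \<open>i \<noteq> j\<close> are evaluated by \<open>E\<^bsub>ij\<^esub> E\<^bsub>ji\<^esub> = E\<^bsub>ji\<^esub> E\<^bsub>ij\<^esub> + E\<^bsub>ii\<^esub> - E\<^bsub>jj\<^esub>\<close>, where only the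
  weights \<open>a = k + l - q\<close> of \<open>i1\<close> and \<open>b = q\<close> of \<open>i2\<close> occur.
\<close>

lemma gl_casimir_highest_weight_vector:
  fixes i1 i2 :: "'n::finite" and q k l :: nat
  defines "v \<equiv> highest_weight_vector i1 i2 k l q"
    and "a \<equiv> real k + real l - real q" and "b \<equiv> real q" and "n \<equiv> real CARD('n)"
  assumes "i1 \<noteq> i2" and "q \<le> min k l" and v: "bihom_poly k l v"
  shows "gl_casimir v \<alpha> \<beta> = (a * (a + n - 1) + b * (b + n - 3)) * v \<alpha> \<beta>"
proof -
  have r0: "polarization i j v = (\<lambda>\<alpha> \<beta>. 0)" if "j \<noteq> i1" "j \<noteq> i2" for i j
    unfolding v_def using that
    by (subst polarization_highest_weight_vector[where c = 0 and d = 0])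
      (auto simp: polarization_determinant)
  have r12: "polarization i1 i2 v = (\<lambda>\<alpha> \<beta>. 0)"
    unfolding v_def using assms(5)
    by (subst polarization_highest_weight_vector[where c = 0 and d = 0])
      (auto simp: polarization_determinant)
  have r11: "polarization i1 i1 v = (\<lambda>\<alpha> \<beta>. a * v \<alpha> \<beta>)"
    unfolding v_def a_def using assms(5,6)
    by (subst polarization_highest_weight_vector[where c = 1 and d = 1])
      (auto simp: polarization_determinant of_nat_diff algebra_simps)
  have r22: "polarization i2 i2 v = (\<lambda>\<alpha> \<beta>. b * v \<alpha> \<beta>)"
    unfolding v_def b_def using assms(5)
    by (subst polarization_highest_weight_vector[where c = 1 and d = 0])
      (auto simp: polarization_determinant algebra_simps)
  define t where "t i j = polarization i j (polarization j i v) \<alpha> \<beta>" for i j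
  note sd = bihom_poly_sd[OF v]
  have t0: "t i j = 0" if "i \<noteq> i1" "i \<noteq> i2" for i j
    using that by (simp add: t_def r0)
  have swap: "t i j = t j i + polarization i i v \<alpha> \<beta> - polarization j j v \<alpha> \<beta>" for i j
    unfolding t_def using polarization_commutator[OF v, of i j j i \<alpha> \<beta>] by simp
  have t11: "t i1 i1 = a * a * v \<alpha> \<beta>" and t22: "t i2 i2 = b * b * v \<alpha> \<beta>"
    by (simp_all add: t_def r11 r22 polarization_cmult sd)
  have t21: "t i2 i1 = 0"
    by (simp add: t_def r12)
  have t12: "t i1 i2 = (a - b) * v \<alpha> \<beta>"
    using swap[of i1 i2] t21 by (simp add: r11 r22 algebra_simps)
  have t1: "t i1 j = a * v \<alpha> \<beta>" and t2: "t i2 j = b * v \<alpha> \<beta>" if "j \<noteq> i1" "j \<noteq> i2" for j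
    using swap[of i1 j] swap[of i2 j] t0[OF that] that by (simp_all add: r11 r22 r0)
  have card: "real (card (UNIV - {i1, i2})) = n - 2"
  proof -
    have "card {i1, i2} \<le> CARD('n)" by (intro card_mono) auto
    then show ?thesis using assms(5) by (simp add: n_def card_Diff_subset of_nat_diff)
  qed
  have split: "(\<Sum>j\<in>UNIV. f j) = f i1 + f i2 + (\<Sum>j\<in>UNIV - {i1, i2}. f j)"
    for f :: "'n \<Rightarrow> real"
    using sum.subset_diff[of "{i1, i2}" UNIV f] assms(5) by simp
  have "gl_casimir v \<alpha> \<beta> = (\<Sum>j\<in>UNIV. t i1 j) + (\<Sum>j\<in>UNIV. t i2 j)"
    unfolding gl_casimir_def t_def[symmetric] by (subst split) (simp add: t0)
  also have "(\<Sum>j\<in>UNIV. t i1 j) = a * a * v \<alpha> \<beta> + (a - b) * v \<alpha> \<beta> + (n - 2) * (a * v \<alpha> \<beta>)"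
    by (subst split) (simp add: t11 t12 t1 card)
  also have "(\<Sum>j\<in>UNIV. t i2 j) = b * b * v \<alpha> \<beta> + (n - 2) * (b * v \<alpha> \<beta>)"
    by (subst split) (simp add: t22 t21 t2 card)
  finally show ?thesis by (simp add: algebra_simps)
qed

lemma bihom_poly_highest_weight_vector:
  assumes "q \<le> min k l"
  shows "bihom_poly k l (highest_weight_vector i1 i2 k l q)"
proof -
  have fs: "bihom_poly 1 1 (\<lambda>\<alpha> \<beta>. \<alpha> $ i * \<beta> $ j)" for i j :: 'a
    using bihom_poly.mult[OF bihom_poly.fst[of i] bihom_poly.snd[of j]] by simp
  have "bihom_poly (q * 1 + (k - q) * Suc 0 + (l - q) * 0) (q * 1 + (k - q) * 0 + (l - q) * Suc 0)
      (highest_weight_vector i1 i2 k l q)"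
    unfolding highest_weight_vector_def[abs_def]
    by (intro bihom_poly.mult bihom_poly_power bihom_poly_diff fs bihom_poly.fst bihom_poly.snd)
  then show ?thesis using assms by simp
qed

lemma bihom_poly_gl_action:
  assumes "bihom_poly k l p"
  shows "bihom_poly k l (gl_action A p)"
  unfolding gl_action_def[abs_def]
  by (intro bihom_poly_sum bihom_poly_cmult bihom_poly_polarization assms)

lemma gl_casimir_gl_action:
  assumes "bihom_poly k l p"
  shows "gl_casimir (gl_action A p) = gl_action A (gl_casimir p)"
proof -
  have *: "gl_casimir (\<lambda>\<alpha> \<beta>. \<Sum>s\<in>S. f s \<alpha> \<beta>) = (\<lambda>\<alpha> \<beta>. \<Sum>s\<in>S. gl_casimir (f s) \<alpha> \<beta>)"
    if "\<And>s. bihom_poly k l (f s)" for f :: "'a \<Rightarrow> 'a bipoly" and S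
    by (induction S rule: infinite_finite_induct)
      (simp_all add: gl_casimir_zero gl_casimir_add[OF that bihom_poly_sum] that)
  show ?thesis
    unfolding gl_action_def[abs_def]
    using assms
    by (simp add: * gl_casimir_cmult[OF bihom_poly_polarization[OF assms]] gl_casimir_commutes
        bihom_poly_sum bihom_poly_cmult bihom_poly_polarization)
qed

text \<open>
  As the Casimir operator commutes with the action, an eigenspace is a submodule. This is what
  carries the value on the highest weight vector over to the module generated by it.
\<close>

lemma gl_casimir_eigenspace_submodule:
  "gl_submodule k l {p. bihom_poly k l p \<and> gl_casimir p = (\<lambda>\<alpha> \<beta>. c * p \<alpha> \<beta>)}"
  unfolding gl_submodule_def
proof (intro conjI allI ballI)
  fix A :: "real ^ 'a ^ 'a" and p :: "'a bipoly"
  assume "p \<in> {p. bihom_poly k l p \<and> gl_casimir p = (\<lambda>\<alpha> \<beta>. c * p \<alpha> \<beta>)}"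
  then have p: "bihom_poly k l p" "gl_casimir p = (\<lambda>\<alpha> \<beta>. c * p \<alpha> \<beta>)"
    by simp_all
  have "gl_casimir (gl_action A p) = (\<lambda>\<alpha> \<beta>. c * gl_action A p \<alpha> \<beta>)"
    unfolding gl_casimir_gl_action[OF p(1)] p(2)
    by (simp add: gl_action_def[abs_def] polarization_cmult bihom_poly_sd[OF p(1)]
        sum_distrib_left mult_ac)
  then show "gl_action A p \<in> {p. bihom_poly k l p \<and> gl_casimir p = (\<lambda>\<alpha> \<beta>. c * p \<alpha> \<beta>)}"
    using p(1) by (simp add: bihom_poly_gl_action)
qed (auto simp: bihomogeneous_iff_bihom_poly bihom_poly.zero gl_casimir_zero bihom_poly.add
    gl_casimir_add bihom_poly_cmult gl_casimir_cmult algebra_simps)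

lemma gl_casimir_V_module:
  fixes i1 i2 :: "'n::finite" and q k l :: nat
  defines "a \<equiv> real k + real l - real q" and "b \<equiv> real q" and "n \<equiv> real CARD('n)"
  assumes "i1 \<noteq> i2" and "q \<le> min k l" and "p \<in> V_module i1 i2 k l q"
  shows "gl_casimir p = (\<lambda>\<alpha> \<beta>. (a * (a + n - 1) + b * (b + n - 3)) * p \<alpha> \<beta>)"
proof -
  let ?W = "{p. bihom_poly k l p \<and>
    gl_casimir p = (\<lambda>\<alpha> \<beta>. (a * (a + n - 1) + b * (b + n - 3)) * p \<alpha> \<beta>)}"
  have "highest_weight_vector i1 i2 k l q \<in> ?W"
    using gl_casimir_highest_weight_vector[OF assms(4,5)
        bihom_poly_highest_weight_vector[OF assms(5)]] bihom_poly_highest_weight_vector[OF assms(5)]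
    unfolding a_def b_def n_def by blast
  then have "V_module i1 i2 k l q \<subseteq> ?W"
    using gl_casimir_eigenspace_submodule unfolding V_module_def by blast
  then show ?thesis using assms(6) by auto
qed



section \<open>Symbols and their Lie derivatives\<close>

text \<open>
  Finite sums of products of a smooth coefficient and a polynomial. On a product, differentiation
  in \<open>x\<close> and the action on covectors affect different factors, which makes them commute.
\<close>

inductive bihom_symbol :: "nat \<Rightarrow> nat \<Rightarrow> 'n::finite symbol \<Rightarrow> bool" for k l
  where
    zero: "bihom_symbol k l (\<lambda>x \<alpha> \<beta>. 0)"
  | tensor: "smooth c \<Longrightarrow> bihom_poly k l p \<Longrightarrow> bihom_symbol k l (\<lambda>x \<alpha> \<beta>. c x * p \<alpha> \<beta>)"
  | add: "bihom_symbol k l P \<Longrightarrow> bihom_symbol k l Q \<Longrightarrow>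
      bihom_symbol k l (\<lambda>x \<alpha> \<beta>. P x \<alpha> \<beta> + Q x \<alpha> \<beta>)"

lemma bihom_symbol_sum:
  assumes "\<And>s. s \<in> S \<Longrightarrow> bihom_symbol k l (P s)"
  shows "bihom_symbol k l (\<lambda>x \<alpha> \<beta>. \<Sum>s\<in>S. P s x \<alpha> \<beta>)"
  using assms
  by (induction S rule: infinite_finite_induct) (auto intro: bihom_symbol.zero bihom_symbol.add)

lemma bihomogeneous_symbols_imp_bihom_symbol:
  assumes "P \<in> bihomogeneous_symbols k l"
  shows "bihom_symbol k l P"
  using assms unfolding bihomogeneous_symbols_def
  by (auto simp: mult.assoc intro!: bihom_symbol_sum bihom_symbol.tensor bihom_poly_monomial)

lemma bihom_symbol_bihom_poly: "bihom_symbol k l P \<Longrightarrow> bihom_poly k l (P x)"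
  by (induction rule: bihom_symbol.induct)
    (auto intro: bihom_poly.zero bihom_poly_cmult bihom_poly.add)

lemma bihom_symbol_differentiable:
  "bihom_symbol k l P \<Longrightarrow> (\<lambda>y. P y \<alpha> \<beta>) differentiable (at x)"
  by (induction rule: bihom_symbol.induct) (auto intro: smooth_differentiable)

definition xderiv :: "'n \<Rightarrow> 'n::finite symbol \<Rightarrow> 'n symbol"
  where "xderiv i P x \<alpha> \<beta> = pderivative i (\<lambda>y. P y \<alpha> \<beta>) x"

lemma xderiv_zero: "xderiv i (\<lambda>x \<alpha> \<beta>. 0) = (\<lambda>x \<alpha> \<beta>. 0)"
  by (simp add: fun_eq_iff xderiv_def)

lemma xderiv_tensor:
  assumes "smooth c"
  shows "xderiv i (\<lambda>x \<alpha> \<beta>. c x * p \<alpha> \<beta>) = (\<lambda>x \<alpha> \<beta>. pderivative i c x * p \<alpha> \<beta>)"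
  using assms
  by (simp add: fun_eq_iff xderiv_def pderivative_mult smooth_differentiable)

lemma xderiv_add:
  assumes "bihom_symbol k l P" "bihom_symbol k l Q"
  shows "xderiv i (\<lambda>x \<alpha> \<beta>. P x \<alpha> \<beta> + Q x \<alpha> \<beta>) = (\<lambda>x \<alpha> \<beta>. xderiv i P x \<alpha> \<beta> + xderiv i Q x \<alpha> \<beta>)"
  using assms[THEN bihom_symbol_differentiable]
  by (simp add: fun_eq_iff xderiv_def pderivative_add)

lemma bihom_symbol_xderiv: "bihom_symbol k l P \<Longrightarrow> bihom_symbol k l (xderiv i P)"
  by (induction rule: bihom_symbol.induct)
    (simp_all add: xderiv_zero xderiv_tensor xderiv_add bihom_symbol.intros smooth_pderivative)

lemma bihom_symbol_polarization:
  "bihom_symbol k l P \<Longrightarrow> bihom_symbol k l (\<lambda>x. polarization i j (P x))"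
proof (induction rule: bihom_symbol.induct)
  case zero
  show ?case by (simp add: bihom_symbol.zero)
next
  case (tensor c p)
  then show ?case
    by (simp add: polarization_cmult bihom_poly_sd bihom_symbol.tensor bihom_poly_polarization)
next
  case (add P Q)
  then show ?case
    by (simp add: polarization_add bihom_symbol_bihom_poly[THEN bihom_poly_sd(1)]
        bihom_symbol.add)
qed

lemma xderiv_polarization:
  "bihom_symbol k l P \<Longrightarrow>
    xderiv a (\<lambda>x. polarization i j (P x)) = (\<lambda>x. polarization i j (xderiv a P x))"
proof (induction rule: bihom_symbol.induct)
  case zero
  show ?case by (simp add: xderiv_zero)
next
  case (tensor c p)
  then show ?case
    by (simp add: polarization_cmult bihom_poly_sd xderiv_tensor)
next
  case (add P Q)
  note sd = bihom_symbol_bihom_poly[THEN bihom_poly_sd(1)]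
  have "xderiv a (\<lambda>x. polarization i j (\<lambda>\<alpha> \<beta>. P x \<alpha> \<beta> + Q x \<alpha> \<beta>)) =
      xderiv a (\<lambda>x \<alpha> \<beta>. polarization i j (P x) \<alpha> \<beta> + polarization i j (Q x) \<alpha> \<beta>)"
    by (simp add: polarization_add sd[OF add.hyps(1)] sd[OF add.hyps(2)])
  also have "\<dots> = (\<lambda>x \<alpha> \<beta>. polarization i j (xderiv a P x) \<alpha> \<beta> + polarization i j (xderiv a Q x) \<alpha> \<beta>)"
    by (simp add: xderiv_add[OF bihom_symbol_polarization[OF add.hyps(1)]
          bihom_symbol_polarization[OF add.hyps(2)]] add.IH)
  also have "\<dots> = (\<lambda>x. polarization i j (xderiv a (\<lambda>x \<alpha> \<beta>. P x \<alpha> \<beta> + Q x \<alpha> \<beta>) x))"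
    by (simp add: xderiv_add[OF add.hyps] polarization_add
        sd[OF bihom_symbol_xderiv[OF add.hyps(1)]] sd[OF bihom_symbol_xderiv[OF add.hyps(2)]])
  finally show ?case .
qed

text \<open>
  The action of an elementary matrix on densities of weight \<open>\<delta>\<close> with values in polynomials: the
  term of order zero of the Lie derivative along \<open>fld_e i j\<close>.
\<close>

definition weighted_polarization :: "real \<Rightarrow> 'n \<Rightarrow> 'n \<Rightarrow> 'n::finite bipoly \<Rightarrow> 'n bipoly"
  where "weighted_polarization \<delta> i j p \<alpha> \<beta> =
    polarization i j p \<alpha> \<beta> - (if i = j then \<delta> else 0) * p \<alpha> \<beta>"

lemma bihom_poly_weighted_polarization:
  assumes "bihom_poly k l p"
  shows "bihom_poly k l (weighted_polarization \<delta> i j p)"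
  unfolding weighted_polarization_def[abs_def]
  by (intro bihom_poly_diff bihom_poly_cmult bihom_poly_polarization assms)

lemma bihom_symbol_cmult:
  "bihom_symbol k l P \<Longrightarrow> bihom_symbol k l (\<lambda>x \<alpha> \<beta>. c * P x \<alpha> \<beta>)"
proof (induction rule: bihom_symbol.induct)
  case (tensor d p)
  show ?case
    using bihom_symbol.tensor[OF tensor(1) bihom_poly_cmult[OF tensor(2), of c]]
    by (simp add: mult_ac)
qed (auto simp: distrib_left intro: bihom_symbol.zero bihom_symbol.add)

lemma bihom_symbol_weighted_polarization:
  assumes "bihom_symbol k l P"
  shows "bihom_symbol k l (\<lambda>x. weighted_polarization \<delta> i j (P x))"
  using bihom_symbol.add[OF bihom_symbol_polarization[OF assms]
      bihom_symbol_cmult[OF assms, of "- (if i = j then \<delta> else 0)"], of i j]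
  unfolding weighted_polarization_def[abs_def] by (cases "i = j") simp_all

lemma weighted_polarization_lincomb:
  assumes "separately_differentiable p" "separately_differentiable r"
  shows "weighted_polarization \<delta> i j (\<lambda>\<alpha> \<beta>. c * p \<alpha> \<beta> + r \<alpha> \<beta>) \<alpha> \<beta> =
    c * weighted_polarization \<delta> i j p \<alpha> \<beta> + weighted_polarization \<delta> i j r \<alpha> \<beta>"
  using assms
  by (simp add: weighted_polarization_def polarization_add polarization_cmult algebra_simps)

lemma xderiv_weighted_polarization:
  assumes "bihom_symbol k l P"
  shows "xderiv a (\<lambda>x. weighted_polarization \<delta> i j (P x)) x \<alpha> \<beta> =
    weighted_polarization \<delta> i j (xderiv a P x) \<alpha> \<beta>"
proof -
  have "xderiv a (\<lambda>x. weighted_polarization \<delta> i j (P x)) x \<alpha> \<beta> =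
      xderiv a (\<lambda>x. polarization i j (P x)) x \<alpha> \<beta> - (if i = j then \<delta> else 0) * xderiv a P x \<alpha> \<beta>"
    using bihom_symbol_differentiable[OF assms]
      bihom_symbol_differentiable[OF bihom_symbol_polarization[OF assms]]
    unfolding xderiv_def weighted_polarization_def
    by (simp add: pderivative_diff pderivative_cmult)
  then show ?thesis
    by (simp add: xderiv_polarization[OF assms] weighted_polarization_def)
qed


section \<open>The Casimir operator of sl(n+1)\<close>

lemma sum_if_delta:
  fixes f :: "'n::finite \<Rightarrow> real"
  shows "(\<Sum>a\<in>UNIV. (if i = a then c else 0) * f a) = c * f i"
  by (simp add: if_distrib[of "\<lambda>u. u * _"] cong: if_cong)

lemma lie_fld_e:
  "lie \<delta> (fld_e i j) P x \<alpha> \<beta> =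
    - (x $ j) * xderiv i P x \<alpha> \<beta> + weighted_polarization \<delta> i j (P x) \<alpha> \<beta>"
proof -
  have comp: "fld_e i j y $ a = (if a = i then -1 else 0) * y $ j" for y a
    by (simp add: fld_e_def axis_def)
  have d: "pderivative b (\<lambda>y. fld_e i j y $ a) x = (if b = j then if a = i then -1 else 0 else 0)"
    for a b
    unfolding comp by (subst pderivative_cmult) auto
  show ?thesis
    unfolding lie_def d unfolding comp xderiv_def weighted_polarization_def
    by (simp add: pderivative_cmult if_distrib[of "\<lambda>u. u * _"] if_distrib[of uminus] sum_negf
        cong: if_cong)
qed

lemma lie_fld_diag:
  "lie \<delta> (fld_diag i) P x \<alpha> \<beta> =
    lie \<delta> (fld_e i i) P x \<alpha> \<beta> + (\<Sum>k\<in>UNIV. lie \<delta> (fld_e k k) P x \<alpha> \<beta>)"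
proof -
  have comp: "fld_diag i y $ a = (if a = i then -1 else 0) * y $ i - y $ a" for y a
    by (simp add: fld_diag_def axis_def)
  have d: "pderivative b (\<lambda>y. fld_diag i y $ a) x =
      (if b = i then if a = i then -1 else 0 else 0) - (if b = a then 1 else 0)" for a b
    unfolding comp by (subst pderivative_diff) (auto simp: pderivative_cmult)
  show ?thesis
    unfolding lie_fld_e unfolding lie_def d unfolding comp xderiv_def weighted_polarization_def
    by (simp add: pderivative_cmult pderivative_diff if_distrib[of "\<lambda>u. u * _"]
        if_distrib[of uminus] sum_negf sum.distrib sum_subtractf left_diff_distrib
        right_diff_distrib distrib_left cong: if_cong)
qed

lemma lie_fld_const: "lie \<delta> (fld_const i) P x \<alpha> \<beta> = - xderiv i P x \<alpha> \<beta>"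
proof -
  have comp: "fld_const i y $ a = (if a = i then -1 else 0)" for y :: "real ^ 'a" and a
    by (simp add: fld_const_def axis_def)
  show ?thesis
    unfolding lie_def comp xderiv_def
    by (simp add: if_distrib[of "\<lambda>u. u * _"] if_distrib[of uminus] cong: if_cong)
qed

text \<open>
  The divergence \<open>(n + 1) x\<^sup>i\<close> of the field splits so that its density term is absorbed exactly by
  the weights in the two sums of weighted polarizations: \<open>x\<^sup>i\<close> by the first, \<open>n x\<^sup>i\<close> by the second.
\<close>

lemma lie_fld_quad:
  "lie \<delta> (fld_quad i) P x \<alpha> \<beta> =
    (\<Sum>k\<in>UNIV. x $ k * (x $ i * xderiv k P x \<alpha> \<beta> - weighted_polarization \<delta> k i (P x) \<alpha> \<beta>))
    - x $ i * (\<Sum>k\<in>UNIV. weighted_polarization \<delta> k k (P x) \<alpha> \<beta>)"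
proof -
  have comp: "fld_quad i y $ a = y $ i * y $ a" for y :: "real ^ 'a" and a
    by (simp add: fld_quad_def)
  have d: "pderivative b (\<lambda>y. fld_quad i y $ a) x =
      (if b = i then x $ a else 0) + (if b = a then x $ i else 0)" for a b
    by (simp add: comp pderivative_mult)
  show ?thesis
    unfolding lie_def d unfolding comp xderiv_def weighted_polarization_def
    by (simp add: if_distrib[of "\<lambda>u. u * _"] if_distrib[of "\<lambda>u. _ * u"] sum.distrib sum_subtractf
        algebra_simps sum_distrib_left cong: if_cong)
qed

lemma lie_fld_e_lie_fld_e:
  assumes "bihom_symbol k l P"
  shows "lie \<delta> (fld_e a b) (lie \<delta> (fld_e c d) P) x \<alpha> \<beta> =
    x $ b * ((if a = d then 1 else 0) * xderiv c P x \<alpha> \<beta> + x $ d * xderiv a (xderiv c P) x \<alpha> \<beta>)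
    - x $ b * weighted_polarization \<delta> c d (xderiv a P x) \<alpha> \<beta>
    - x $ d * weighted_polarization \<delta> a b (xderiv c P x) \<alpha> \<beta>
    + weighted_polarization \<delta> a b (weighted_polarization \<delta> c d (P x)) \<alpha> \<beta>"
proof -
  note diff = bihom_symbol_differentiable
  have L: "lie \<delta> (fld_e c d) P = (\<lambda>x \<alpha> \<beta>. - (x $ d) * xderiv c P x \<alpha> \<beta>
      + weighted_polarization \<delta> c d (P x) \<alpha> \<beta>)"
    by (simp add: fun_eq_iff lie_fld_e)
  have "xderiv a (lie \<delta> (fld_e c d) P) x \<alpha> \<beta> =
      - ((if a = d then 1 else 0) * xderiv c P x \<alpha> \<beta> + x $ d * xderiv a (xderiv c P) x \<alpha> \<beta>)
      + weighted_polarization \<delta> c d (xderiv a P x) \<alpha> \<beta>"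
    unfolding L xderiv_weighted_polarization[OF assms, symmetric]
    using diff[OF bihom_symbol_xderiv[OF assms]] diff[OF bihom_symbol_weighted_polarization[OF assms]]
    by (simp add: xderiv_def[of a] pderivative_diff pderivative_mult)
  note xd = this
  have wp: "weighted_polarization \<delta> a b (lie \<delta> (fld_e c d) P x) \<alpha> \<beta> =
      - (x $ d) * weighted_polarization \<delta> a b (xderiv c P x) \<alpha> \<beta>
      + weighted_polarization \<delta> a b (weighted_polarization \<delta> c d (P x)) \<alpha> \<beta>"
    unfolding L
    by (rule weighted_polarization_lincomb
        bihom_poly_separately_differentiable bihom_symbol_bihom_poly bihom_symbol_xderiv
        bihom_poly_weighted_polarization assms)+
  show ?thesis
    unfolding lie_fld_e[of _ a b] xd wp by (simp add: algebra_simps)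
qed

lemma xderiv_lie_fld_quad:
  assumes "bihom_symbol k l P"
  shows "xderiv i (lie \<delta> (fld_quad i) P) x \<alpha> \<beta> =
    (\<Sum>k\<in>UNIV. x $ k * xderiv k P x \<alpha> \<beta>) + x $ i * xderiv i P x \<alpha> \<beta>
    + (\<Sum>k\<in>UNIV. x $ k * (x $ i * xderiv i (xderiv k P) x \<alpha> \<beta>
        - weighted_polarization \<delta> k i (xderiv i P x) \<alpha> \<beta>))
    - weighted_polarization \<delta> i i (P x) \<alpha> \<beta>
    - (\<Sum>k\<in>UNIV. weighted_polarization \<delta> k k (P x) \<alpha> \<beta>)
    - x $ i * (\<Sum>k\<in>UNIV. weighted_polarization \<delta> k k (xderiv i P x) \<alpha> \<beta>)"
proof -
  have L: "lie \<delta> (fld_quad i) P = (\<lambda>x \<alpha> \<beta>.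
      (\<Sum>k\<in>UNIV. x $ k * (x $ i * xderiv k P x \<alpha> \<beta> - weighted_polarization \<delta> k i (P x) \<alpha> \<beta>))
      - x $ i * (\<Sum>k\<in>UNIV. weighted_polarization \<delta> k k (P x) \<alpha> \<beta>))"
    by (simp add: fun_eq_iff lie_fld_quad)
  have "xderiv i (lie \<delta> (fld_quad i) P) x \<alpha> \<beta> =
      (\<Sum>k\<in>UNIV. (if i = k then 1 else 0) *
          (x $ i * xderiv k P x \<alpha> \<beta> - weighted_polarization \<delta> k i (P x) \<alpha> \<beta>)
        + x $ k * (xderiv k P x \<alpha> \<beta> + x $ i * xderiv i (xderiv k P) x \<alpha> \<beta>
          - xderiv i (\<lambda>x. weighted_polarization \<delta> k i (P x)) x \<alpha> \<beta>))
      - ((\<Sum>k\<in>UNIV. weighted_polarization \<delta> k k (P x) \<alpha> \<beta>)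
        + x $ i * (\<Sum>k\<in>UNIV. xderiv i (\<lambda>x. weighted_polarization \<delta> k k (P x)) x \<alpha> \<beta>))"
    unfolding L
    using bihom_symbol_differentiable[OF bihom_symbol_xderiv[OF assms]]
      bihom_symbol_differentiable[OF bihom_symbol_weighted_polarization[OF assms]]
    by (simp add: xderiv_def pderivative_diff pderivative_mult pderivative_sum)
  then show ?thesis
    unfolding xderiv_weighted_polarization[OF assms]
    by (simp add: sum.distrib sum_if_delta distrib_left right_diff_distrib sum_subtractf)
qed

text \<open>
  The Casimir operator does not differentiate in \<open>x\<close>. Expanding every product of Lie derivatives,
  the second derivatives of \<open>P\<close> cancel between the linear fields (coefficient 2) and the constant
  and quadratic ones (coefficient -2); so do the terms with one derivative, among them those left by
  differentiating the coefficients of the fields. What remains are the products of the weighted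
  polarizations of the linear fields, and the \<open>n + 1\<close> copies of the trace that arise when the constant
  field \<open>-\<partial>\<^sub>i\<close> differentiates the coefficients of the weighted polarizations in \<open>lie_fld_quad\<close>.
\<close>

lemma casimir_pointwise:
  fixes P :: "'n::finite symbol"
  assumes P: "bihom_symbol k l P"
  shows "casimir \<delta> P x \<alpha> \<beta> =
    (\<Sum>i\<in>UNIV. \<Sum>j\<in>UNIV. weighted_polarization \<delta> i j (weighted_polarization \<delta> j i (P x)) \<alpha> \<beta>)
    + (\<Sum>i\<in>UNIV. \<Sum>k\<in>UNIV. weighted_polarization \<delta> k k (weighted_polarization \<delta> i i (P x)) \<alpha> \<beta>)
    + (real CARD('n) + 1) * (\<Sum>i\<in>UNIV. weighted_polarization \<delta> i i (P x) \<alpha> \<beta>)"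
proof -
  define D where "D i = xderiv i P x \<alpha> \<beta>" for i
  define H where "H i j = xderiv i (xderiv j P) x \<alpha> \<beta>" for i j
  define B where "B a c d = weighted_polarization \<delta> c d (xderiv a P x) \<alpha> \<beta>" for a c d
  define A where "A i j = weighted_polarization \<delta> i j (P x) \<alpha> \<beta>" for i j
  define G where "G a b c d = weighted_polarization \<delta> a b (weighted_polarization \<delta> c d (P x)) \<alpha> \<beta>"
    for a b c d
  note defs = D_def[symmetric] H_def[symmetric] B_def[symmetric] A_def[symmetric] G_def[symmetric]
  have dual: "fld_diag_dual = (\<lambda>i :: 'n. fld_e i i)"
    by (simp add: fun_eq_iff fld_diag_dual_def fld_e_def)
  have const: "lie \<delta> (fld_const i) P = (\<lambda>x \<alpha> \<beta>. - 1 * xderiv i P x \<alpha> \<beta>)" for i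
    by (simp add: fun_eq_iff lie_fld_const)
  have ee: "lie \<delta> (fld_e a b) (lie \<delta> (fld_e c d) P) x \<alpha> \<beta> =
      x $ b * ((if a = d then 1 else 0) * D c + x $ d * H a c)
      - x $ b * B a c d - x $ d * B c a b + G a b c d" for a b c d
    unfolding lie_fld_e_lie_fld_e[OF P] defs ..
  have cq: "lie \<delta> (fld_const i) (lie \<delta> (fld_quad i) P) x \<alpha> \<beta> =
      - (\<Sum>k\<in>UNIV. x $ k * D k) - x $ i * D i
      - (\<Sum>k\<in>UNIV. x $ k * (x $ i * H i k - B i k i))
      + A i i + (\<Sum>k\<in>UNIV. A k k) + x $ i * (\<Sum>k\<in>UNIV. B i k k)" for i
    unfolding lie_fld_const xderiv_lie_fld_quad[OF P] defs by simp
  have qc: "lie \<delta> (fld_quad i) (lie \<delta> (fld_const i) P) x \<alpha> \<beta> =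
      - (\<Sum>k\<in>UNIV. x $ k * (x $ i * H k i - B i k i)) + x $ i * (\<Sum>k\<in>UNIV. B i k k)" for i
  proof -
    have "xderiv k (lie \<delta> (fld_const i) P) x \<alpha> \<beta> = - H k i" for k
      unfolding const H_def xderiv_def[of k]
      using pderivative_cmult[OF bihom_symbol_differentiable[OF bihom_symbol_xderiv[OF P]], of k "-1"]
      by simp
    moreover have "weighted_polarization \<delta> a b (lie \<delta> (fld_const i) P x) \<alpha> \<beta> = - B i a b" for a b
      using weighted_polarization_lincomb[OF bihom_poly_separately_differentiable[OF
            bihom_symbol_bihom_poly[OF bihom_symbol_xderiv[OF P]]]
          separately_differentiable_const[of 0], of \<delta> a b "-1" i x \<alpha> \<beta>]
      unfolding const B_def by (simp add: weighted_polarization_def)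
    ultimately show ?thesis
      unfolding lie_fld_quad by (simp add: sum_negf sum_subtractf algebra_simps)
  qed
  have off: "(\<Sum>j\<in>UNIV - {i}. lie \<delta> (fld_e i j) (lie \<delta> (fld_e j i) P) x \<alpha> \<beta>) =
      (\<Sum>j\<in>UNIV. lie \<delta> (fld_e i j) (lie \<delta> (fld_e j i) P) x \<alpha> \<beta>)
      - lie \<delta> (fld_e i i) (lie \<delta> (fld_e i i) P) x \<alpha> \<beta>" for i
    using sum.remove[of UNIV i "\<lambda>j. lie \<delta> (fld_e i j) (lie \<delta> (fld_e j i) P) x \<alpha> \<beta>"] by simp
  (* Exchanges of summation indices; in the second one the coefficients are symmetric, which makes
     up for the order of the two x-derivatives. *)
  have sw: "(\<Sum>i\<in>UNIV. \<Sum>j\<in>UNIV. x $ j * B i j i) = (\<Sum>i\<in>UNIV. x $ i * (\<Sum>j\<in>UNIV. B j i j))"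
    "(\<Sum>i\<in>UNIV. \<Sum>j\<in>UNIV. x $ j * (x $ i * H j i)) = (\<Sum>i\<in>UNIV. \<Sum>j\<in>UNIV. x $ j * (x $ i * H i j))"
    "(\<Sum>i\<in>UNIV. \<Sum>j\<in>UNIV. x $ j * B j i i) = (\<Sum>i\<in>UNIV. \<Sum>j\<in>UNIV. x $ i * B i j j)"
    by (subst sum.swap, simp add: mult_ac sum_distrib_left)+
  have "casimir \<delta> P x \<alpha> \<beta> =
      (\<Sum>i\<in>UNIV. \<Sum>j\<in>UNIV. lie \<delta> (fld_e i j) (lie \<delta> (fld_e j i) P) x \<alpha> \<beta>)
      + (\<Sum>i\<in>UNIV. \<Sum>k\<in>UNIV. lie \<delta> (fld_e k k) (lie \<delta> (fld_e i i) P) x \<alpha> \<beta>)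
      + (\<Sum>i\<in>UNIV. lie \<delta> (fld_const i) (lie \<delta> (fld_quad i) P) x \<alpha> \<beta>)
      + (\<Sum>i\<in>UNIV. lie \<delta> (fld_quad i) (lie \<delta> (fld_const i) P) x \<alpha> \<beta>)"
    unfolding casimir_def off lie_fld_diag dual by (simp add: sum.distrib sum_subtractf)
  also have "\<dots> = (\<Sum>i\<in>UNIV. \<Sum>j\<in>UNIV. G i j j i) + (\<Sum>i\<in>UNIV. \<Sum>k\<in>UNIV. G k k i i)
      + (real CARD('n) + 1) * (\<Sum>i\<in>UNIV. A i i)"
    unfolding ee cq qc
    by (simp add: sum.distrib sum_subtractf sum_negf right_diff_distrib distrib_left sw
        sum_distrib_left[symmetric] if_distrib[of "\<lambda>u. u * _"] if_distrib[of "\<lambda>u. _ * u"]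
        distrib_right cong: if_cong)
  finally show ?thesis unfolding defs .
qed

text \<open>
  The three sums in \<open>casimir_pointwise\<close> on polynomials of degree \<open>(k, l)\<close>. Only the first involves
  more than traces, which are scalars by Euler's identity.
\<close>

lemma weighted_casimir:
  fixes p :: "'n::finite bipoly"
  assumes p: "bihom_poly k l p"
  defines "n \<equiv> real CARD('n)" and "d \<equiv> real k + real l"
  shows "(\<Sum>i\<in>UNIV. \<Sum>j\<in>UNIV. weighted_polarization \<delta> i j (weighted_polarization \<delta> j i p) \<alpha> \<beta>) =
      gl_casimir p \<alpha> \<beta> - (2 * \<delta> * d - n * \<delta>\<^sup>2) * p \<alpha> \<beta>"
    and "(\<Sum>i\<in>UNIV. \<Sum>k\<in>UNIV. weighted_polarization \<delta> k k (weighted_polarization \<delta> i i p) \<alpha> \<beta>) =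
      (d - n * \<delta>)\<^sup>2 * p \<alpha> \<beta>"
    and "(\<Sum>i\<in>UNIV. weighted_polarization \<delta> i i p \<alpha> \<beta>) = (d - n * \<delta>) * p \<alpha> \<beta>"
proof -
  have euler: "(\<Sum>i\<in>UNIV. weighted_polarization \<delta> i i r \<alpha> \<beta>) = (d - n * \<delta>) * r \<alpha> \<beta>"
    if "bihom_poly k l r" for r :: "'n bipoly"
    using polarization_euler[OF that]
    by (simp add: weighted_polarization_def sum_subtractf d_def n_def algebra_simps)
  from euler[OF p] show "(\<Sum>i\<in>UNIV. weighted_polarization \<delta> i i p \<alpha> \<beta>) = (d - n * \<delta>) * p \<alpha> \<beta>" .
  show "(\<Sum>i\<in>UNIV. \<Sum>k\<in>UNIV. weighted_polarization \<delta> k k (weighted_polarization \<delta> i i p) \<alpha> \<beta>) =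
      (d - n * \<delta>)\<^sup>2 * p \<alpha> \<beta>"
    by (simp add: euler[OF bihom_poly_weighted_polarization[OF p]] euler[OF p] power2_eq_square
        flip: sum_distrib_left)
  have "weighted_polarization \<delta> i j (weighted_polarization \<delta> j i p) \<alpha> \<beta> =
      polarization i j (polarization j i p) \<alpha> \<beta>
      + (if i = j then \<delta>\<^sup>2 * p \<alpha> \<beta> - 2 * \<delta> * polarization i i p \<alpha> \<beta> else 0)" for i j
    by (cases "i = j") (simp_all add: weighted_polarization_def[abs_def] polarization_diff
        polarization_cmult bihom_poly_sd[OF p] power2_eq_square algebra_simps)
  then show "(\<Sum>i\<in>UNIV. \<Sum>j\<in>UNIV. weighted_polarization \<delta> i j (weighted_polarization \<delta> j i p) \<alpha> \<beta>) =
      gl_casimir p \<alpha> \<beta> - (2 * \<delta> * d - n * \<delta>\<^sup>2) * p \<alpha> \<beta>"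
    using polarization_euler[OF p, of \<alpha> \<beta>]
    by (simp add: sum.distrib sum_subtractf gl_casimir_def n_def d_def algebra_simps
        flip: sum_distrib_left)
qed

theorem lemma2:
  fixes \<delta> :: real and k l q :: nat and i1 i2 :: "'n::finite" and n :: real
    and P :: "'n symbol"
  assumes "n = real CARD('n)" and "CARD('n) \<ge> 2"
    and "i1 \<noteq> i2"
    and "q \<le> min k l"
    and "P \<in> symbols i1 i2 k l q"
  shows "casimir \<delta> P =
    (\<lambda>x \<alpha> \<beta>. (n * (n + 1) * \<delta> * (\<delta> - 1)
               - 2 * ((n + 1) * \<delta> - n + real q) * (real k + real l)
               + 2 * (real k + real l) ^ 2
               + 2 * real q * (real q - 1)) * P x \<alpha> \<beta>)"
proof (intro ext)
  fix x \<alpha> \<beta> :: "real ^ 'n"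
  have P: "bihom_symbol k l P" and V: "P x \<in> V_module i1 i2 k l q"
    using assms(5) by (auto simp: symbols_def intro: bihomogeneous_symbols_imp_bihom_symbol)
  show "casimir \<delta> P x \<alpha> \<beta> = (n * (n + 1) * \<delta> * (\<delta> - 1)
               - 2 * ((n + 1) * \<delta> - n + real q) * (real k + real l)
               + 2 * (real k + real l) ^ 2
               + 2 * real q * (real q - 1)) * P x \<alpha> \<beta>"
    unfolding casimir_pointwise[OF P] weighted_casimir[OF bihom_symbol_bihom_poly[OF P]]
      gl_casimir_V_module[OF assms(3,4) V] assms(1)
    by (simp add: algebra_simps power2_eq_square)
qed

end
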